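(* Let $M$ be a surface immersed in $\mathbb{R}^5$, let $m\in M$, and let $(t_1,t_2)$ be a basis of $T_mM$. A vector $0\ne x\in T_mM$ defines an asymptotic direction at $m$ if and only if $$\det\big(\alpha_m(x,t_1),\alpha_m(x,t_2),(\nabla_x\alpha)(x,x)\big)=0,$$ where the determinant is that of three vectors in the three-dimensional normal space $N_mM$.
   Context: $D$ denotes the directional derivative in $\mathbb{R}^5$, $N_mM$ the normal space of $M$ at $m$, and $X=X^\top+X^\bot$ the decomposition into tangent and normal parts. The second fundamental form is $\alpha(X,Y)=(D_XY)^\bot$; with $\nabla^\top_XY=(D_XY)^\top$ and $\nabla^\bot_Xu=(D_Xu)^\bot$, its covariant derivative is $(\nabla_X\alpha)(Y,Z)=\nabla^\bot_X(\alpha(Y,Z))-\alpha(\nabla^\top_XY,Z)-\alpha(Y,\nabla^\top_XZ)$. The determinant in $N_mM$ is taken with respect to an orthonormal basis. For $0\ne u\in\mathbb{R}^5$, let $f_{3,u}$ be the third order Taylor polynomial at $0$ of $x\in T_mM\mapsto u\cdot(\exp_m(x)-m)$, where $\exp_m$ is the exponential map of $M$ at $m$; explicitly $$f_{3,u}(x)= u\cdot x + \tfrac12u\cdot\alpha_m(x,x) -\tfrac16 \alpha_m(u^\top,x)\cdot\alpha_m(x,x)+\tfrac16 u^\bot\cdot(\nabla_x\alpha)(x,x).$$ The vector $u\neq0$ determines a binormal direction at $m$ if (i) $0$ is a singular (critical) point of $f_{3,u}$, and (ii) there is a non-vanishing $x\in T_mM$ such that $u\cdot\alpha_m(x,y)=0$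 for all $y\in T_mM$ and $f_{3,u}(x)=0$. Any such vector $x$ (for some $u\ne0$ satisfying (i)) is said to define an asymptotic direction at $m$. *)

theory Defs
  imports "HOL-Analysis.Analysis"
begin

section \<open>Smooth maps and immersed surfaces\<close>

text \<open>Only meant for open \<open>S\<close>: the derivatives are the full ones, not those within \<open>S\<close>.\<close>

primrec Ck_on :: "nat \<Rightarrow> 'a::real_normed_vector set \<Rightarrow> ('a \<Rightarrow> 'b::real_normed_vector) \<Rightarrow> bool" where
  "Ck_on 0 S f \<longleftrightarrow> continuous_on S f"
| "Ck_on (Suc k) S f \<longleftrightarrow>
     (\<forall>x\<in>S. f differentiable (at x)) \<and> (\<forall>v. Ck_on k S (\<lambda>x. frechet_derivative f (at x) v))"

definition smooth_on :: "'a::real_normed_vector set \<Rightarrow> ('a \<Rightarrow> 'b::real_normed_vector) \<Rightarrow> bool" where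
  "smooth_on S f \<longleftrightarrow> (\<forall>k. Ck_on k S f)"

text \<open>A chart is a pair \<open>(U, \<phi>)\<close> consisting of an open set of parameters and a local
  parametrization \<open>\<phi>\<close>, which goes from the plane to the surface.\<close>

type_synonym 'p chart = "(real^2) set \<times> (real^2 \<Rightarrow> 'p)"

definition smooth_atlas :: "'p topology \<Rightarrow> 'p chart set \<Rightarrow> bool" where
  "smooth_atlas S A \<longleftrightarrow>
     (\<forall>(U, \<phi>)\<in>A. open U \<and> embedding_map (top_of_set U) S \<phi> \<and> openin S (\<phi> ` U)) \<and>
     (\<Union>(U, \<phi>)\<in>A. \<phi> ` U) = topspace S \<and>
     (\<forall>(U, \<phi>)\<in>A. \<forall>(V, \<psi>)\<in>A. smooth_on {a\<in>U. \<phi> a \<in> \<psi> ` V} (inv_into V \<psi> \<circ> \<phi>))"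

definition smooth_surface :: "'p topology \<Rightarrow> 'p chart set \<Rightarrow> bool" where
  "smooth_surface S A \<longleftrightarrow> Hausdorff_space S \<and> second_countable S \<and> smooth_atlas S A"

definition immersion :: "'p chart set \<Rightarrow> ('p \<Rightarrow> real^5) \<Rightarrow> bool" where
  "immersion A F \<longleftrightarrow>
     (\<forall>(U, \<phi>)\<in>A. smooth_on U (F \<circ> \<phi>) \<and> (\<forall>a\<in>U. inj (frechet_derivative (F \<circ> \<phi>) (at a))))"

text \<open>The surface immersed in 5-space is \<open>F : S \<rightarrow> \<real>\<^sup>5\<close>. It may have self-intersections, so its
  points are points \<open>p\<close> of \<open>S\<close>, and vector fields along it are maps from \<open>S\<close> to 5-space.\<close>

definition tangent_space_at :: "'p chart set \<Rightarrow> ('p \<Rightarrow> real^5) \<Rightarrow> 'p \<Rightarrow> (real^5) set" where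
  "tangent_space_at A F p =
     {x. \<exists>(U, \<phi>)\<in>A. \<exists>a\<in>U. \<exists>\<xi>. \<phi> a = p \<and> x = frechet_derivative (F \<circ> \<phi>) (at a) \<xi>}"

definition normal_space_at :: "'p chart set \<Rightarrow> ('p \<Rightarrow> real^5) \<Rightarrow> 'p \<Rightarrow> (real^5) set" where
  "normal_space_at A F p = (tangent_space_at A F p)\<^sup>\<bottom>"

definition tan_part :: "'p chart set \<Rightarrow> ('p \<Rightarrow> real^5) \<Rightarrow> 'p \<Rightarrow> real^5 \<Rightarrow> real^5" where
  "tan_part A F p v = (THE w. w \<in> tangent_space_at A F p \<and> v - w \<in> normal_space_at A F p)"

definition nor_part :: "'p chart set \<Rightarrow> ('p \<Rightarrow> real^5) \<Rightarrow> 'p \<Rightarrow> real^5 \<Rightarrow> real^5" where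
  "nor_part A F p v = v - tan_part A F p v"

section \<open>Second fundamental form and its covariant derivative\<close>

text \<open>\<open>dir_deriv A F p x Z\<close> is the directional derivative \<open>D\<^sub>x Z\<close> at \<open>p\<close> of a map \<open>Z\<close> on the
  surface, for a tangent vector \<open>x\<close> at \<open>p\<close>. It is computed in a chart, where \<open>x\<close> corresponds
  to \<open>\<xi>\<close>; the value does not depend on the chart when \<open>Z\<close> is differentiable at \<open>p\<close>.\<close>

definition dir_deriv ::
  "'p chart set \<Rightarrow> ('p \<Rightarrow> real^5) \<Rightarrow> 'p \<Rightarrow> real^5 \<Rightarrow> ('p \<Rightarrow> real^5) \<Rightarrow> real^5" where
  "dir_deriv A F p x Z =
     (THE v. \<exists>(U, \<phi>)\<in>A. \<exists>a\<in>U. \<exists>\<xi>. \<phi> a = p \<and> x = frechet_derivative (F \<circ> \<phi>) (at a) \<xi> \<and>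
        v = frechet_derivative (Z \<circ> \<phi>) (at a) \<xi>)"

definition tangent_field_on ::
  "'p topology \<Rightarrow> 'p chart set \<Rightarrow> ('p \<Rightarrow> real^5) \<Rightarrow> 'p set \<Rightarrow> ('p \<Rightarrow> real^5) \<Rightarrow> bool" where
  "tangent_field_on S A F W Y \<longleftrightarrow>
     openin S W \<and> (\<forall>q\<in>W. Y q \<in> tangent_space_at A F q) \<and>
     (\<forall>(U, \<phi>)\<in>A. smooth_on {a\<in>U. \<phi> a \<in> W} (Y \<circ> \<phi>))"

text \<open>Both tensors are evaluated on vectors at \<open>p\<close> by extending these to smooth tangent fields on
  a neighbourhood of \<open>p\<close>; the result does not depend on the extensions.\<close>

definition sff ::
  "'p topology \<Rightarrow> 'p chart set \<Rightarrow> ('p \<Rightarrow> real^5) \<Rightarrow> 'p \<Rightarrow> real^5 \<Rightarrow> real^5 \<Rightarrow> real^5" where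
  "sff S A F p x y =
     (THE w. \<exists>W Y. p \<in> W \<and> tangent_field_on S A F W Y \<and> Y p = y \<and>
        w = nor_part A F p (dir_deriv A F p x Y))"

definition cov_sff ::
  "'p topology \<Rightarrow> 'p chart set \<Rightarrow> ('p \<Rightarrow> real^5) \<Rightarrow> 'p \<Rightarrow> real^5 \<Rightarrow> real^5 \<Rightarrow> real^5 \<Rightarrow> real^5" where
  "cov_sff S A F p x y z =
     (THE w. \<exists>W Y Z. p \<in> W \<and> tangent_field_on S A F W Y \<and> tangent_field_on S A F W Z \<and>
        Y p = y \<and> Z p = z \<and>
        w = nor_part A F p (dir_deriv A F p x (\<lambda>q. sff S A F q (Y q) (Z q)))
            - sff S A F p (tan_part A F p (dir_deriv A F p x Y)) z
            - sff S A F p y (tan_part A F p (dir_deriv A F p x Z)))"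

section \<open>Asymptotic directions\<close>

text \<open>The third order Taylor polynomial at \<open>0\<close> of \<open>x \<mapsto> u \<bullet> (exp\<^sub>m x - m)\<close> on the tangent space.
  Along the geodesic \<open>c t = exp\<^sub>m (t x)\<close> one has \<open>c'' = \<alpha>(c', c')\<close>. Hence \<open>c'''\<close> has normal part
  \<open>(\<nabla>\<^bsub>c'\<^esub>\<alpha>)(c', c')\<close>, and its inner product with a tangent vector \<open>v\<close> is
  \<open>- \<alpha>(v, c') \<bullet> \<alpha>(c', c')\<close>.\<close>

definition taylor3 ::
  "'p topology \<Rightarrow> 'p chart set \<Rightarrow> ('p \<Rightarrow> real^5) \<Rightarrow> 'p \<Rightarrow> real^5 \<Rightarrow> real^5 \<Rightarrow> real" where
  "taylor3 S A F m u x =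
     u \<bullet> x + 1/2 * (u \<bullet> sff S A F m x x)
     - 1/6 * (sff S A F m (tan_part A F m u) x \<bullet> sff S A F m x x)
     + 1/6 * (nor_part A F m u \<bullet> cov_sff S A F m x x x)"

definition taylor3_critical ::
  "'p topology \<Rightarrow> 'p chart set \<Rightarrow> ('p \<Rightarrow> real^5) \<Rightarrow> 'p \<Rightarrow> real^5 \<Rightarrow> bool" where
  "taylor3_critical S A F m u \<longleftrightarrow>
     (taylor3 S A F m u has_derivative (\<lambda>_. 0)) (at 0 within tangent_space_at A F m)"

definition binormal_witness ::
  "'p topology \<Rightarrow> 'p chart set \<Rightarrow> ('p \<Rightarrow> real^5) \<Rightarrow> 'p \<Rightarrow> real^5 \<Rightarrow> real^5 \<Rightarrow> bool" where
  "binormal_witness S A F m u x \<longleftrightarrow>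
     x \<in> tangent_space_at A F m \<and> x \<noteq> 0 \<and>
     (\<forall>y\<in>tangent_space_at A F m. u \<bullet> sff S A F m x y = 0) \<and> taylor3 S A F m u x = 0"

text \<open>The vector \<open>u\<close> below is one that determines a binormal direction at \<open>m\<close>.\<close>

definition asymptotic_direction ::
  "'p topology \<Rightarrow> 'p chart set \<Rightarrow> ('p \<Rightarrow> real^5) \<Rightarrow> 'p \<Rightarrow> real^5 \<Rightarrow> bool" where
  "asymptotic_direction S A F m x \<longleftrightarrow>
     (\<exists>u. u \<noteq> 0 \<and> taylor3_critical S A F m u \<and> binormal_witness S A F m u x)"

section \<open>Determinants in a three-dimensional subspace\<close>

definition orthonormal_basis :: "(real^5) set \<Rightarrow> (3 \<Rightarrow> real^5) \<Rightarrow> bool" where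
  "orthonormal_basis N e \<longleftrightarrow>
     (\<forall>i j. e i \<bullet> e j = (if i = j then 1 else 0)) \<and> span (range e) = N"

definition det_wrt :: "(3 \<Rightarrow> real^5) \<Rightarrow> real^5 \<Rightarrow> real^5 \<Rightarrow> real^5 \<Rightarrow> real" where
  "det_wrt e v1 v2 v3 =
     det (vector [\<chi> j. v1 \<bullet> e j, \<chi> j. v2 \<bullet> e j, \<chi> j. v3 \<bullet> e j] :: real^3^3)"

end

theory Submission
  imports Defs
begin

text \<open>
  Linear algebra decides the theorem once the two tensors are known to be tensors. The linear part
  of the Taylor polynomial \<open>f\<^sub>u\<close> is \<open>x \<mapsto> u \<bullet> x\<close> on the tangent space \<open>T\<close>, and the rest is of
  second order, so \<open>0\<close> is critical exactly when \<open>u\<close> is normal. For normal \<open>u\<close> the term with the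
  tangential part of \<open>u\<close> vanishes; if also \<open>u \<bullet> \<alpha>(x, y) = 0\<close> for all tangent \<open>y\<close>, then
  \<open>f\<^sub>u(x) = 1/6 (u \<bullet> (\<nabla>\<^sub>x\<alpha>)(x, x))\<close>. As \<open>\<alpha>(x, y)\<close> is linear in \<open>y\<close>, the vector \<open>x\<close> is asymptotic if
  and only if some normal \<open>u \<noteq> 0\<close> is orthogonal to \<open>\<alpha>(x, t\<^sub>1)\<close>, \<open>\<alpha>(x, t\<^sub>2)\<close> and \<open>(\<nabla>\<^sub>x\<alpha>)(x, x)\<close>
  (\<open>asymptotic_direction_iff_normal_vector\<close>). In an orthonormal basis of the normal space this is
  a homogeneous \<open>3 \<times> 3\<close> system for the coefficients of \<open>u\<close>, with a nonzero solution exactly when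
  its determinant is zero (\<open>det_wrt_eq_0_iff\<close>).

  The work lies in the tensors: \<open>\<alpha>\<close> and \<open>\<nabla>\<alpha>\<close> are defined by extending vectors to smooth tangent
  fields, so one needs that such extensions exist, that the values do not depend on them, and that
  they are multilinear. All of this is read off in one chart. A vector extends to the field with
  constant components in the coordinate frame \<open>(\<partial>\<^sub>1, \<partial>\<^sub>2)\<close> of the chart; it is smooth in every
  other chart since smooth maps compose. Components of an arbitrary tangent field with respect to
  the frame are differentiable, because Cramer's rule for the Gram matrix gives them explicitly
  (\<open>gram_coef\<close>). Differentiating \<open>Y = Y\<^sup>1\<partial>\<^sub>1 + Y\<^sup>2\<partial>\<^sub>2\<close> leaves the derivatives of the components in
  tangential terms only, so its normal part is bilinear in the direction and the value of \<open>Y\<close> at the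
  point (\<open>sff_eq\<close>). In \<open>\<nabla>\<alpha>\<close> the derivatives of the components of both fields cancel by the Leibniz
  rule, which leaves a trilinear expression (\<open>cov_sff_eq\<close>).
\<close>

section \<open>Calculus of smooth maps\<close>

text \<open>The derivatives at a point of an open set depend only on the values in that set. This is what
  lets a formula for a derivative, valid inside the set, be differentiated again.\<close>

lemma Ck_on_cong:
  assumes "open S" and "\<And>x. x \<in> S \<Longrightarrow> f x = g x" and "Ck_on k S f"
  shows "Ck_on k S g"
  using assms(2,3)
proof (induction k arbitrary: f g)
  case 0
  then show ?case by (simp cong: continuous_on_cong)
next
  case (Suc k)
  have d: "g differentiable (at x)"
    "frechet_derivative f (at x) = frechet_derivative g (at x)" if "x \<in> S" for x
  proof -
    have f: "f differentiable (at x)" using Suc.prems(2) that by simp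
    then show "frechet_derivative f (at x) = frechet_derivative g (at x)"
      using frechet_derivative_transform_within_open[OF f assms(1) that Suc.prems(1)] by blast
    obtain D where "(f has_derivative D) (at x)" using f by (auto simp: differentiable_def)
    then have "(g has_derivative D) (at x)"
      by (rule has_derivative_transform_within_open[OF _ assms(1) that]) (rule Suc.prems(1))
    then show "g differentiable (at x)" by (auto simp: differentiable_def)
  qed
  have "Ck_on k S (\<lambda>x. frechet_derivative g (at x) v)" for v
    using Suc.IH[of "\<lambda>x. frechet_derivative f (at x) v"] d(2) Suc.prems(2) by simp
  with d(1) show ?case by simp
qed

lemma Ck_on_SucD: "Ck_on (Suc k) S f \<Longrightarrow> Ck_on k S f"
proof (induction k arbitrary: f)
  case 0
  then show ?case
    by (auto intro!: differentiable_imp_continuous_on differentiable_at_imp_differentiable_on)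
next
  case (Suc k)
  then show ?case unfolding Ck_on.simps(2)[of "Suc k"] Ck_on.simps(2)[of k S f] by blast
qed

lemma Ck_on_const: "Ck_on k S (\<lambda>_. c)"
  by (induction k arbitrary: c) (simp_all add: frechet_derivative_const)

lemma Ck_on_bounded_linear:
  assumes "open S" and "bounded_linear L" and "Ck_on k S f"
  shows "Ck_on k S (\<lambda>x. L (f x))"
  using assms(3)
proof (induction k arbitrary: f)
  case 0
  then show ?case
    by (simp add: bounded_linear.continuous_on[OF assms(2)])
next
  case (Suc k)
  have d: "((\<lambda>x. L (f x)) has_derivative (\<lambda>v. L (frechet_derivative f (at x) v))) (at x)"
    if "x \<in> S" for x
    using Suc.prems that
    by (intro bounded_linear.has_derivative[OF assms(2)]) (simp add: frechet_derivative_works[symmetric])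
  have "Ck_on k S (\<lambda>x. L (frechet_derivative f (at x) v))" for v
    using Suc.prems by (intro Suc.IH) simp
  then have "Ck_on k S (\<lambda>x. frechet_derivative (\<lambda>x. L (f x)) (at x) v)" for v
    by (rule Ck_on_cong[OF assms(1), rotated]) (simp add: frechet_derivative_at[OF d, symmetric])
  with d show ?case unfolding Ck_on.simps differentiable_def by blast
qed

lemma Ck_on_add:
  assumes "open S" and "Ck_on k S f" and "Ck_on k S g"
  shows "Ck_on k S (\<lambda>x. f x + g x)"
  using assms(2,3)
proof (induction k arbitrary: f g)
  case 0
  then show ?case by (simp add: continuous_on_add)
next
  case (Suc k)
  have d: "((\<lambda>x. f x + g x) has_derivative
      (\<lambda>v. frechet_derivative f (at x) v + frechet_derivative g (at x) v)) (at x)"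
    if "x \<in> S" for x
    using Suc.prems that
    by (intro has_derivative_add) (simp_all add: frechet_derivative_works[symmetric])
  have "Ck_on k S (\<lambda>x. frechet_derivative f (at x) v + frechet_derivative g (at x) v)" for v
    using Suc.prems by (intro Suc.IH) simp_all
  then have "Ck_on k S (\<lambda>x. frechet_derivative (\<lambda>x. f x + g x) (at x) v)" for v
    by (rule Ck_on_cong[OF assms(1), rotated]) (simp add: frechet_derivative_at[OF d, symmetric])
  with d show ?case unfolding Ck_on.simps differentiable_def by blast
qed

lemma Ck_on_sum:
  assumes "open S" and "\<And>i. i \<in> I \<Longrightarrow> Ck_on k S (f i)"
  shows "Ck_on k S (\<lambda>x. \<Sum>i\<in>I. f i x)"
  using assms(2)
  by (induction I rule: infinite_finite_induct)
    (auto intro: Ck_on_const Ck_on_add[OF assms(1)])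

text \<open>By the Leibniz rule, a derivative of the product is a sum of products in which one factor is
  differentiated; the other factor is only used to one order less.\<close>

lemma Ck_on_scaleR:
  assumes "open S" and "Ck_on k S f" and "Ck_on k S g"
  shows "Ck_on k S (\<lambda>x. f x *\<^sub>R g x)"
  using assms(2,3)
proof (induction k arbitrary: f g)
  case 0
  then show ?case by (simp add: continuous_on_scaleR)
next
  case (Suc k)
  have d: "((\<lambda>x. f x *\<^sub>R g x) has_derivative
      (\<lambda>v. f x *\<^sub>R frechet_derivative g (at x) v + frechet_derivative f (at x) v *\<^sub>R g x)) (at x)"
    if "x \<in> S" for x
    using Suc.prems that by (intro has_derivative_scaleR) (simp_all add: frechet_derivative_works[symmetric])
  have "Ck_on k S (\<lambda>x. f x *\<^sub>R frechet_derivative g (at x) v + frechet_derivative f (at x) v *\<^sub>R g x)" for v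
    using Suc.prems by (intro Ck_on_add Suc.IH assms(1))
      (simp_all add: Ck_on_SucD[OF Suc.prems(1)] Ck_on_SucD[OF Suc.prems(2)])
  then have "Ck_on k S (\<lambda>x. frechet_derivative (\<lambda>x. f x *\<^sub>R g x) (at x) v)" for v
    by (rule Ck_on_cong[OF assms(1), rotated]) (simp add: frechet_derivative_at[OF d, symmetric])
  with d show ?case unfolding Ck_on.simps differentiable_def by blast
qed

text \<open>The chain rule \<open>D(f \<circ> \<tau>) v = (\<Sum>i. (D\<tau> v \<bullet> i) *\<^sub>R (Df i \<circ> \<tau>))\<close> turns one more derivative of
  the composite into products of functions to which the induction hypothesis applies.\<close>

lemma Ck_on_compose:
  fixes f :: "'b::euclidean_space \<Rightarrow> 'c::real_normed_vector" and \<tau> :: "'a::real_normed_vector \<Rightarrow> 'b"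
  assumes "open S" and "\<tau> ` S \<subseteq> R" and "Ck_on k S \<tau>" and "Ck_on k R f"
  shows "Ck_on k S (f \<circ> \<tau>)"
  using assms(3,4)
proof (induction k arbitrary: f)
  case 0
  have "continuous_on (\<tau> ` S) f"
    using 0 assms(2) by (simp add: continuous_on_subset)
  with 0 show ?case by (simp only: Ck_on.simps continuous_on_compose)
next
  case (Suc k)
  have d: "((f \<circ> \<tau>) has_derivative
      (\<lambda>v. frechet_derivative f (at (\<tau> x)) (frechet_derivative \<tau> (at x) v))) (at x)"
    if "x \<in> S" for x
  proof -
    have "(\<tau> has_derivative frechet_derivative \<tau> (at x)) (at x)"
      using Suc.prems(1) that by (simp add: frechet_derivative_works[symmetric])
    moreover have "(f has_derivative frechet_derivative f (at (\<tau> x))) (at (\<tau> x))"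
      using Suc.prems(2) that assms(2) by (auto simp: frechet_derivative_works[symmetric])
    ultimately show ?thesis unfolding o_def by (rule has_derivative_compose)
  qed
  have eq: "frechet_derivative (f \<circ> \<tau>) (at x) v =
      (\<Sum>i\<in>Basis. (frechet_derivative \<tau> (at x) v \<bullet> i) *\<^sub>R
        ((\<lambda>y. frechet_derivative f (at y) i) \<circ> \<tau>) x)" if x: "x \<in> S" for x v
  proof -
    have "f differentiable (at (\<tau> x))" using Suc.prems x assms(2) by auto
    then have lin: "linear (frechet_derivative f (at (\<tau> x)))"
      by (rule linear_frechet_derivative)
    have "frechet_derivative (f \<circ> \<tau>) (at x) v =
        frechet_derivative f (at (\<tau> x)) (frechet_derivative \<tau> (at x) v)"
      by (simp add: frechet_derivative_at[OF d[OF x], symmetric])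
    also have "\<dots> = frechet_derivative f (at (\<tau> x))
        (\<Sum>i\<in>Basis. (frechet_derivative \<tau> (at x) v \<bullet> i) *\<^sub>R i)"
      by (simp add: euclidean_representation)
    finally show ?thesis by (simp add: linear_sum[OF lin] linear_cmul[OF lin])
  qed
  have "Ck_on k S (\<lambda>x. \<Sum>i\<in>Basis. (frechet_derivative \<tau> (at x) v \<bullet> i) *\<^sub>R
        ((\<lambda>y. frechet_derivative f (at y) i) \<circ> \<tau>) x)" for v
  proof (intro Ck_on_sum Ck_on_scaleR assms(1))
    fix i :: 'b
    show "Ck_on k S (\<lambda>x. frechet_derivative \<tau> (at x) v \<bullet> i)"
      using Suc.prems(1) by (intro Ck_on_bounded_linear[OF assms(1) bounded_linear_inner_left]) simp
    show "Ck_on k S ((\<lambda>y. frechet_derivative f (at y) i) \<circ> \<tau>)"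
      using Suc.prems(2) by (intro Suc.IH Ck_on_SucD[OF Suc.prems(1)]) simp
  qed
  then have "Ck_on k S (\<lambda>x. frechet_derivative (f \<circ> \<tau>) (at x) v)" for v
    by (rule Ck_on_cong[OF assms(1), rotated]) (simp add: eq)
  with d show ?case unfolding Ck_on.simps differentiable_def by blast
qed

lemma smooth_on_compose:
  fixes f :: "'b::euclidean_space \<Rightarrow> 'c::real_normed_vector" and \<tau> :: "'a::real_normed_vector \<Rightarrow> 'b"
  assumes "open S" and "\<tau> ` S \<subseteq> R" and "smooth_on S \<tau>" and "smooth_on R f"
  shows "smooth_on S (f \<circ> \<tau>)"
  unfolding smooth_on_def
proof
  fix k
  show "Ck_on k S (f \<circ> \<tau>)"
    by (rule Ck_on_compose[OF assms(1,2)]) (use assms(3,4) in \<open>simp_all only: smooth_on_def\<close>)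
qed

lemma smooth_on_frechet_derivative:
  "smooth_on S f \<Longrightarrow> smooth_on S (\<lambda>x. frechet_derivative f (at x) v)"
  unfolding smooth_on_def by (metis Ck_on.simps(2))

lemma smooth_on_differentiable: "smooth_on S f \<Longrightarrow> x \<in> S \<Longrightarrow> f differentiable (at x)"
  unfolding smooth_on_def by (metis Ck_on.simps(2))

section \<open>Coordinates with respect to a frame\<close>

text \<open>Cramer's rule for the Gram matrix of \<open>(g, h)\<close>: the coefficient of \<open>g\<close> in the orthogonal
  projection of \<open>v\<close> to the plane spanned by \<open>g\<close> and \<open>h\<close>. Being explicit, it is visibly
  differentiable in all three vectors.\<close>

definition gram_coef :: "'a::real_inner \<Rightarrow> 'a \<Rightarrow> 'a \<Rightarrow> real" where
  "gram_coef g h v =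
     ((v \<bullet> g) * (h \<bullet> h) - (v \<bullet> h) * (g \<bullet> h)) / ((g \<bullet> g) * (h \<bullet> h) - (g \<bullet> h) * (g \<bullet> h))"

lemma linear_gram_coef: "linear (gram_coef g h)"
  by (rule linearI)
    (simp_all add: gram_coef_def inner_simps algebra_simps
      add_divide_distrib[symmetric] diff_divide_distrib[symmetric])

text \<open>The case of equality in the Cauchy-Schwarz inequality: the vector \<open>(h \<bullet> h) g - (g \<bullet> h) h\<close> has
  squared length \<open>h \<bullet> h\<close> times the Gram determinant.\<close>

lemma gram_det_nonzero:
  assumes "\<And>r s. r *\<^sub>R g + s *\<^sub>R h = 0 \<Longrightarrow> r = 0 \<and> s = 0"
  shows "(g \<bullet> g) * (h \<bullet> h) - (g \<bullet> h) * (g \<bullet> h) \<noteq> 0"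
proof
  assume z: "(g \<bullet> g) * (h \<bullet> h) - (g \<bullet> h) * (g \<bullet> h) = 0"
  let ?w = "(h \<bullet> h) *\<^sub>R g + (- (g \<bullet> h)) *\<^sub>R h"
  have "?w \<bullet> ?w = (h \<bullet> h) * ((g \<bullet> g) * (h \<bullet> h) - (g \<bullet> h) * (g \<bullet> h))"
    by (simp add: inner_simps algebra_simps inner_commute)
  with z have "?w = 0" by simp
  then have "h \<bullet> h = 0" using assms by blast
  then have "0 *\<^sub>R g + 1 *\<^sub>R h = 0" by simp
  with assms show False by fastforce
qed

lemma gram_coef_combination:
  assumes "\<And>r s. r *\<^sub>R g + s *\<^sub>R h = 0 \<Longrightarrow> r = 0 \<and> s = 0"
  shows "gram_coef g h (r *\<^sub>R g + s *\<^sub>R h) = r"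
proof -
  have N: "((r *\<^sub>R g + s *\<^sub>R h) \<bullet> g) * (h \<bullet> h) - ((r *\<^sub>R g + s *\<^sub>R h) \<bullet> h) * (g \<bullet> h)
     = r * ((g \<bullet> g) * (h \<bullet> h) - (g \<bullet> h) * (g \<bullet> h))"
    by (simp add: inner_simps algebra_simps inner_commute)
  show ?thesis
    unfolding gram_coef_def N by (rule nonzero_mult_div_cancel_right) (rule gram_det_nonzero[OF assms])
qed

lemma inner_gram_combination:
  assumes "\<And>r s. r *\<^sub>R g + s *\<^sub>R h = 0 \<Longrightarrow> r = 0 \<and> s = 0"
  shows "(v - (gram_coef g h v *\<^sub>R g + gram_coef h g v *\<^sub>R h)) \<bullet> g = 0"
proof -
  have nz: "(g \<bullet> g) * (h \<bullet> h) - (g \<bullet> h) * (g \<bullet> h) \<noteq> 0" by (rule gram_det_nonzero[OF assms])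
  have "gram_coef g h v * (g \<bullet> g) + gram_coef h g v * (h \<bullet> g) = v \<bullet> g"
    using nz unfolding gram_coef_def
    by (simp add: inner_commute[of h g] mult.commute[of "h \<bullet> h"] add_divide_distrib[symmetric] divide_simps)
       (simp add: algebra_simps)
  then show ?thesis by (simp add: inner_simps)
qed

lemma gram_coef_differentiable:
  assumes "g differentiable (at a)" "h differentiable (at a)" "v differentiable (at a)"
    and "\<And>r s. r *\<^sub>R g a + s *\<^sub>R h a = 0 \<Longrightarrow> r = 0 \<and> s = 0"
  shows "(\<lambda>b. gram_coef (g b) (h b) (v b)) differentiable (at a)"
  unfolding gram_coef_def
  using assms(1-3) gram_det_nonzero[OF assms(4)]
  by (intro differentiable_divide differentiable_diff differentiable_mult differentiable_inner)

text \<open>The index type of the plane has arithmetic modulo \<open>2\<close>, so \<open>i + 1\<close> is the index other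
  than \<open>i\<close>. This treats both coordinates alike.\<close>

lemma sum_index2: "sum c UNIV = c i + c (i + 1)" for c :: "2 \<Rightarrow> 'a::comm_monoid_add" and i
proof (cases "i = 1")
  case True
  then show ?thesis by (simp add: sum_2)
next
  case False
  then have i: "i = 2" using exhaust_2[of i] by simp
  have "(2::2) + 1 = 1" by simp
  then show ?thesis unfolding i by (simp only: sum_2 add.commute[of "c 1"])
qed

lemma index2_twice: "(i::2) + 1 + 1 = i"
  using exhaust_2[of i] by auto

section \<open>Charts of an immersed surface\<close>

lemma orthogonal_decomposition_unique:
  fixes T :: "'a::real_inner set"
  assumes "subspace T" and "w \<in> T" "v - w \<in> T\<^sup>\<bottom>" and "w' \<in> T" "v - w' \<in> T\<^sup>\<bottom>"
  shows "w = w'"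
proof -
  have "w - w' \<in> T" using assms by (simp add: subspace_diff)
  then have "(v - w') \<bullet> (w - w') = 0" "(v - w) \<bullet> (w - w') = 0"
    using assms(3,5) by (auto simp: orthogonal_comp_def orthogonal_def inner_commute)
  then have "(w - w') \<bullet> (w - w') = 0" by (simp add: inner_simps)
  then show ?thesis by simp
qed

locale immersed_surface =
  fixes S :: "'p topology" and A :: "'p chart set" and F :: "'p \<Rightarrow> real^5"
  assumes surface: "smooth_surface S A" and immersed: "immersion A F"
begin

lemma chart_open: "(U, \<phi>) \<in> A \<Longrightarrow> open U"
  using surface by (auto simp: smooth_surface_def smooth_atlas_def)

lemma chart_embedding: "(U, \<phi>) \<in> A \<Longrightarrow> embedding_map (top_of_set U) S \<phi>"
  using surface by (auto simp: smooth_surface_def smooth_atlas_def)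

lemma chart_inj: "(U, \<phi>) \<in> A \<Longrightarrow> inj_on \<phi> U"
proof -
  assume c: "(U, \<phi>) \<in> A"
  have "homeomorphic_map (top_of_set U) (subtopology S (\<phi> ` topspace (top_of_set U))) \<phi>"
    using chart_embedding[OF c] unfolding embedding_map_def .
  from homeomorphic_imp_injective_map[OF this] show "inj_on \<phi> U" by simp
qed

lemma chart_image_open: "(U, \<phi>) \<in> A \<Longrightarrow> openin S (\<phi> ` U)"
  using surface by (auto simp: smooth_surface_def smooth_atlas_def)

lemma chart_preimage_open:
  assumes "(U, \<phi>) \<in> A" and "openin S W"
  shows "open {a \<in> U. \<phi> a \<in> W}"
proof -
  have "continuous_map (top_of_set U) S \<phi>"
    using chart_embedding[OF assms(1)] unfolding embedding_map_def
    by (blast dest: homeomorphic_imp_continuous_map intro: continuous_map_into_fulltopology)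
  then have "openin (top_of_set U) {a \<in> U. \<phi> a \<in> W}"
    using assms(2) by (auto simp: continuous_map_def)
  then show ?thesis using chart_open[OF assms(1)] openin_open_trans by blast
qed

lemma transition_smooth:
  assumes "(U, \<phi>) \<in> A" and "(V, \<psi>) \<in> A"
  shows "smooth_on {b \<in> V. \<psi> b \<in> \<phi> ` U} (inv_into U \<phi> \<circ> \<psi>)"
proof -
  have "\<forall>(U, \<phi>)\<in>A. \<forall>(V, \<psi>)\<in>A. smooth_on {a\<in>U. \<phi> a \<in> \<psi> ` V} (inv_into V \<psi> \<circ> \<phi>)"
    using surface unfolding smooth_surface_def smooth_atlas_def by (elim conjE)
  from bspec[OF this assms(2)]
  have "\<forall>(U, \<phi>)\<in>A. smooth_on {b \<in> V. \<psi> b \<in> \<phi> ` U} (inv_into U \<phi> \<circ> \<psi>)"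
    by (simp only: prod.case)
  from bspec[OF this assms(1)] show ?thesis by (simp only: prod.case)
qed

lemma chart_at:
  assumes "p \<in> topspace S"
  obtains U \<phi> a where "(U, \<phi>) \<in> A" "a \<in> U" "\<phi> a = p"
proof -
  have "(\<Union>(U, \<phi>)\<in>A. \<phi> ` U) = topspace S"
    using surface unfolding smooth_surface_def smooth_atlas_def by (elim conjE)
  with assms have "p \<in> (\<Union>(U, \<phi>)\<in>A. \<phi> ` U)" by (simp only:)
  then show ?thesis by (auto intro: that)
qed

text \<open>\<open>T\<close> is the derivative of the transition map. It is chosen before \<open>Z\<close>: comparing the case of
  \<open>F\<close> with that of another map is what shows directional derivatives to be well defined.\<close>

lemma derivative_change_of_chart:
  assumes "(U, \<phi>) \<in> A" "a \<in> U" and "(V, \<psi>) \<in> A" "b \<in> V" and "\<phi> a = \<psi> b"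
  obtains T where "\<And>Z::'p \<Rightarrow> real^5. (Z \<circ> \<phi>) differentiable (at a) \<Longrightarrow>
    frechet_derivative (Z \<circ> \<psi>) (at b) = frechet_derivative (Z \<circ> \<phi>) (at a) \<circ> T"
proof
  let ?\<tau> = "inv_into U \<phi> \<circ> \<psi>" and ?V = "{b \<in> V. \<psi> b \<in> \<phi> ` U}"
  have b: "b \<in> ?V" using assms(4) imageI[OF assms(2), of \<phi>] assms(5) by simp
  have V: "open ?V" by (rule chart_preimage_open[OF assms(3) chart_image_open[OF assms(1)]])
  have \<tau>b: "?\<tau> b = a" using assms(2,5) inv_into_f_f[OF chart_inj[OF assms(1)] assms(2)] by simp
  have d\<tau>: "(?\<tau> has_derivative frechet_derivative ?\<tau> (at b)) (at b)"
    using smooth_on_differentiable[OF transition_smooth[OF assms(1,3)] b]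
    by (simp add: frechet_derivative_works)
  show "frechet_derivative (Z \<circ> \<psi>) (at b) =
      frechet_derivative (Z \<circ> \<phi>) (at a) \<circ> frechet_derivative ?\<tau> (at b)"
    if Z: "(Z \<circ> \<phi>) differentiable (at a)" for Z :: "'p \<Rightarrow> real^5"
  proof -
    have "((Z \<circ> \<phi>) has_derivative frechet_derivative (Z \<circ> \<phi>) (at a)) (at (?\<tau> b))"
      using Z unfolding \<tau>b by (simp add: frechet_derivative_works)
    from diff_chain_at[OF d\<tau> this]
    have "((Z \<circ> \<psi>) has_derivative frechet_derivative (Z \<circ> \<phi>) (at a) \<circ> frechet_derivative ?\<tau> (at b)) (at b)"
      by (rule has_derivative_transform_within_open[OF _ V b]) (auto simp: f_inv_into_f)
    then show ?thesis by (rule frechet_derivative_at[symmetric])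
  qed
qed

end

locale surface_chart = immersed_surface S A F
  for S :: "'p topology" and A :: "'p chart set" and F :: "'p \<Rightarrow> real^5" +
  fixes U :: "(real^2) set" and \<phi> :: "real^2 \<Rightarrow> 'p"
  assumes chart: "(U, \<phi>) \<in> A"
begin

abbreviation D\<phi> :: "real^2 \<Rightarrow> real^2 \<Rightarrow> real^5" where
  "D\<phi> a \<equiv> frechet_derivative (F \<circ> \<phi>) (at a)"

lemma open_domain: "open U"
  using chart by (rule chart_open)

lemma param_smooth: "smooth_on U (F \<circ> \<phi>)"
  using immersed chart by (auto simp: immersion_def)

lemma param_differentiable: "a \<in> U \<Longrightarrow> (F \<circ> \<phi>) differentiable (at a)"
  by (rule smooth_on_differentiable[OF param_smooth])

lemma D\<phi>_linear: "a \<in> U \<Longrightarrow> linear (D\<phi> a)"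
  by (rule linear_frechet_derivative[OF param_differentiable])

lemma D\<phi>_inj: "a \<in> U \<Longrightarrow> inj (D\<phi> a)"
  using immersed chart by (auto simp: immersion_def)

lemma tangent_space_eq_range:
  assumes "a \<in> U"
  shows "tangent_space_at A F (\<phi> a) = range (D\<phi> a)"
proof (intro equalityI subsetI)
  fix x assume "x \<in> tangent_space_at A F (\<phi> a)"
  then obtain V \<psi> b \<xi> where b: "(V, \<psi>) \<in> A" "b \<in> V" "\<phi> a = \<psi> b"
    and x: "x = frechet_derivative (F \<circ> \<psi>) (at b) \<xi>"
    by (auto simp: tangent_space_at_def)
  obtain T where "\<And>Z::'p \<Rightarrow> real^5. (Z \<circ> \<phi>) differentiable (at a) \<Longrightarrow>
      frechet_derivative (Z \<circ> \<psi>) (at b) = frechet_derivative (Z \<circ> \<phi>) (at a) \<circ> T"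
    using derivative_change_of_chart[OF chart assms b] by blast
  then show "x \<in> range (D\<phi> a)" using x param_differentiable[OF assms] by simp
next
  fix x assume "x \<in> range (D\<phi> a)"
  then show "x \<in> tangent_space_at A F (\<phi> a)"
    using chart assms by (auto simp: tangent_space_at_def)
qed

lemma tangent_subspace: "a \<in> U \<Longrightarrow> subspace (tangent_space_at A F (\<phi> a))"
  by (simp add: tangent_space_eq_range linear_subspace_image D\<phi>_linear)

text \<open>If a tangent vector is represented by \<open>\<xi>\<close> in this chart and by \<open>\<eta>\<close> in another one, then
  injectivity of the derivative of \<open>F \<circ> \<phi>\<close> forces \<open>\<xi> = T \<eta>\<close> for the derivative \<open>T\<close> of the
  transition map, and both charts give the same value.\<close>

lemma dir_deriv_eq:
  assumes a: "a \<in> U" and Z: "(Z \<circ> \<phi>) differentiable (at a)"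
  shows "dir_deriv A F (\<phi> a) (D\<phi> a \<xi>) Z = frechet_derivative (Z \<circ> \<phi>) (at a) \<xi>"
  unfolding dir_deriv_def
proof (rule the_equality)
  show "\<exists>(V, \<psi>)\<in>A. \<exists>b\<in>V. \<exists>\<eta>. \<psi> b = \<phi> a \<and> D\<phi> a \<xi> = frechet_derivative (F \<circ> \<psi>) (at b) \<eta> \<and>
      frechet_derivative (Z \<circ> \<phi>) (at a) \<xi> = frechet_derivative (Z \<circ> \<psi>) (at b) \<eta>"
    using chart a by blast
next
  fix v
  assume "\<exists>(V, \<psi>)\<in>A. \<exists>b\<in>V. \<exists>\<eta>. \<psi> b = \<phi> a \<and> D\<phi> a \<xi> = frechet_derivative (F \<circ> \<psi>) (at b) \<eta> \<and>
      v = frechet_derivative (Z \<circ> \<psi>) (at b) \<eta>"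
  then obtain V \<psi> b \<eta> where b: "(V, \<psi>) \<in> A" "b \<in> V" "\<phi> a = \<psi> b"
    and \<xi>: "D\<phi> a \<xi> = frechet_derivative (F \<circ> \<psi>) (at b) \<eta>"
    and v: "v = frechet_derivative (Z \<circ> \<psi>) (at b) \<eta>"
    by auto
  obtain T where T: "\<And>Z::'p \<Rightarrow> real^5. (Z \<circ> \<phi>) differentiable (at a) \<Longrightarrow>
      frechet_derivative (Z \<circ> \<psi>) (at b) = frechet_derivative (Z \<circ> \<phi>) (at a) \<circ> T"
    using derivative_change_of_chart[OF chart a b] by blast
  have "D\<phi> a \<xi> = D\<phi> a (T \<eta>)" using \<xi> T[OF param_differentiable[OF a]] by simp
  then have "\<xi> = T \<eta>" using D\<phi>_inj[OF a] by (simp add: inj_eq)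
  then show "v = frechet_derivative (Z \<circ> \<phi>) (at a) \<xi>" using v T[OF Z] by simp
qed

text \<open>The field has constant components \<open>\<eta>\<close> in the coordinate frame. Seen in another chart it is
  composed with a transition map, hence smooth there as well.\<close>

lemma extension_field:
  obtains Y where "tangent_field_on S A F (\<phi> ` U) Y" and "\<And>a. a \<in> U \<Longrightarrow> Y (\<phi> a) = D\<phi> a \<eta>"
proof
  let ?Y = "\<lambda>q. D\<phi> (inv_into U \<phi> q) \<eta>"
  show Y: "?Y (\<phi> a) = D\<phi> a \<eta>" if "a \<in> U" for a
    using inv_into_f_f[OF chart_inj[OF chart] that] by simp
  have "smooth_on {b \<in> V. \<psi> b \<in> \<phi> ` U} (?Y \<circ> \<psi>)" if V: "(V, \<psi>) \<in> A" for V \<psi>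
  proof -
    have "smooth_on {b \<in> V. \<psi> b \<in> \<phi> ` U} ((\<lambda>a. D\<phi> a \<eta>) \<circ> (inv_into U \<phi> \<circ> \<psi>))"
    proof (rule smooth_on_compose)
      show "open {b \<in> V. \<psi> b \<in> \<phi> ` U}"
        by (rule chart_preimage_open[OF V chart_image_open[OF chart]])
      show "(inv_into U \<phi> \<circ> \<psi>) ` {b \<in> V. \<psi> b \<in> \<phi> ` U} \<subseteq> U"
        by (auto intro: inv_into_into)
    qed (rule transition_smooth[OF chart V] smooth_on_frechet_derivative[OF param_smooth])+
    then show ?thesis by (simp add: o_def)
  qed
  then show "tangent_field_on S A F (\<phi> ` U) ?Y"
    using chart_image_open[OF chart] Y tangent_space_eq_range
    by (auto simp: tangent_field_on_def)
qed

text \<open>The coordinate frame of the chart, and the components in it of the tangential part of a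
  vector of the ambient space. Since \<open>coord i a\<close> is defined on the whole space, tangent fields and
  forms on tangent spaces are handled without restricting domains.\<close>

definition frame :: "2 \<Rightarrow> real^2 \<Rightarrow> real^5" where
  "frame i a = D\<phi> a (axis i 1)"

definition coord :: "2 \<Rightarrow> real^2 \<Rightarrow> real^5 \<Rightarrow> real" where
  "coord i a = gram_coef (frame i a) (frame (i + 1) a)"

lemma coord_linear: "linear (coord i a)"
  unfolding coord_def by (rule linear_gram_coef)

lemma D\<phi>_frame: "a \<in> U \<Longrightarrow> D\<phi> a \<xi> = (\<Sum>i\<in>UNIV. \<xi> $ i *\<^sub>R frame i a)"
proof -
  assume a: "a \<in> U"
  have "D\<phi> a \<xi> = D\<phi> a (\<Sum>i\<in>UNIV. \<xi> $ i *\<^sub>R axis i 1)"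
    by (metis (no_types, lifting) basis_expansion sum.cong scalar_mult_eq_scaleR)
  then show ?thesis
    by (simp add: linear_sum[OF D\<phi>_linear[OF a]] linear_cmul[OF D\<phi>_linear[OF a]] frame_def)
qed

lemma frame_independent:
  assumes "a \<in> U" and "r *\<^sub>R frame i a + s *\<^sub>R frame (i + 1) a = 0"
  shows "r = 0 \<and> s = 0"
proof -
  let ?\<xi> = "(\<chi> j. if j = i then r else s) :: real^2"
  have ne: "i + 1 \<noteq> i" by simp
  have "D\<phi> a ?\<xi> = 0"
    using assms ne by (simp add: D\<phi>_frame sum_index2[of _ i])
  then have "?\<xi> = 0"
    using D\<phi>_inj[OF assms(1)] D\<phi>_linear[OF assms(1)] linear_injective_0 by blast
  then have "?\<xi> $ i = 0" "?\<xi> $ (i + 1) = 0" by simp_all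
  with ne show ?thesis by simp
qed

lemma coord_combination:
  assumes "a \<in> U"
  shows "coord i a (\<Sum>j\<in>UNIV. c j *\<^sub>R frame j a) = c i"
  unfolding sum_index2[of _ i] coord_def
  by (rule gram_coef_combination) (rule frame_independent[OF assms])

lemma coord_D\<phi>: "a \<in> U \<Longrightarrow> coord i a (D\<phi> a \<xi>) = \<xi> $ i"
  by (simp add: D\<phi>_frame coord_combination)

lemma tan_part_eq:
  assumes a: "a \<in> U"
  shows "tan_part A F (\<phi> a) v = (\<Sum>i\<in>UNIV. coord i a v *\<^sub>R frame i a)"
    (is "_ = ?w")
proof -
  have w: "?w = D\<phi> a (\<chi> i. coord i a v)"
    using a by (simp add: D\<phi>_frame)
  then have 1: "?w \<in> tangent_space_at A F (\<phi> a)"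
    using a by (simp add: tangent_space_eq_range)
  have "(v - ?w) \<bullet> frame i a = 0" for i
    unfolding sum_index2[of _ i] coord_def index2_twice
    by (rule inner_gram_combination) (rule frame_independent[OF a])
  then have 2: "v - ?w \<in> normal_space_at A F (\<phi> a)"
    using a by (auto simp: normal_space_at_def orthogonal_comp_def orthogonal_def
        tangent_space_eq_range D\<phi>_frame inner_sum_left inner_sum_right inner_commute)
  show ?thesis
    unfolding tan_part_def
    by (rule the_equality)
      (use 1 2 orthogonal_decomposition_unique[OF tangent_subspace[OF a]]
        in \<open>auto simp: normal_space_at_def\<close>)
qed

section \<open>The second fundamental form in a chart\<close>

lemma nor_part_eq: "a \<in> U \<Longrightarrow> nor_part A F (\<phi> a) v = v - (\<Sum>i\<in>UNIV. coord i a v *\<^sub>R frame i a)"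
  by (simp add: nor_part_def tan_part_eq)

lemma nor_part_linear: "a \<in> U \<Longrightarrow> linear (nor_part A F (\<phi> a))"
  by (rule linearI)
    (simp_all add: nor_part_eq linear_add[OF coord_linear] linear_cmul[OF coord_linear]
      scaleR_add_left sum.distrib scaleR_diff_right scaleR_sum_right)

lemma nor_part_combination: "a \<in> U \<Longrightarrow> nor_part A F (\<phi> a) (\<Sum>i\<in>UNIV. c i *\<^sub>R frame i a) = 0"
  by (simp add: nor_part_eq coord_combination)

lemma nor_part_idem: "a \<in> U \<Longrightarrow> nor_part A F (\<phi> a) (nor_part A F (\<phi> a) v) = nor_part A F (\<phi> a) v"
  using linear_diff[OF nor_part_linear] nor_part_combination by (simp add: nor_part_eq[of a v])

definition param_vec :: "real^2 \<Rightarrow> real^5 \<Rightarrow> real^2" where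
  "param_vec a x = (\<chi> i. coord i a x)"

lemma param_vec_linear: "linear (param_vec a)"
  by (rule linearI)
    (simp_all add: param_vec_def vec_eq_iff linear_add[OF coord_linear] linear_cmul[OF coord_linear])

lemma D\<phi>_param_vec:
  assumes "a \<in> U" and "x \<in> tangent_space_at A F (\<phi> a)"
  shows "D\<phi> a (param_vec a x) = x"
proof -
  obtain \<xi> where \<xi>: "x = D\<phi> a \<xi>" using assms tangent_space_eq_range by auto
  have "param_vec a x = \<xi>"
    unfolding param_vec_def \<xi> by (simp add: coord_D\<phi>[OF assms(1)])
  with \<xi> show ?thesis by simp
qed

lemma tangent_combination:
  assumes "a \<in> U" and "x \<in> tangent_space_at A F (\<phi> a)"
  shows "x = (\<Sum>i\<in>UNIV. coord i a x *\<^sub>R frame i a)"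
  using D\<phi>_param_vec[OF assms] D\<phi>_frame[OF assms(1), of "param_vec a x"]
  by (simp add: param_vec_def)

lemma frame_smooth: "smooth_on U (frame i)"
  using smooth_on_frechet_derivative[OF param_smooth, of "axis i 1"]
  unfolding frame_def[abs_def] .

lemma frame_differentiable: "a \<in> U \<Longrightarrow> frame i differentiable (at a)"
  by (rule smooth_on_differentiable[OF frame_smooth])

lemma coord_differentiable:
  assumes "a \<in> U" and "v differentiable (at a)"
  shows "(\<lambda>b. coord i b (v b)) differentiable (at a)"
  unfolding coord_def
  by (rule gram_coef_differentiable[OF frame_differentiable[OF assms(1)]
        frame_differentiable[OF assms(1)] assms(2) frame_independent[OF assms(1)]])

text \<open>The value of the second fundamental form on the frame vectors \<open>i\<close> and \<open>j\<close>.\<close>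

definition sff_coef :: "2 \<Rightarrow> 2 \<Rightarrow> real^2 \<Rightarrow> real^5" where
  "sff_coef i j a = nor_part A F (\<phi> a) (frechet_derivative (frame j) (at a) (axis i 1))"

lemma sff_coef_differentiable:
  assumes a: "a \<in> U"
  shows "sff_coef i j differentiable (at a)"
proof -
  let ?v = "\<lambda>b. frechet_derivative (frame j) (at b) (axis i 1)"
  have v: "?v differentiable (at a)"
    by (rule smooth_on_differentiable[OF smooth_on_frechet_derivative[OF frame_smooth] a])
  have "(\<lambda>b. ?v b - (\<Sum>k\<in>UNIV. coord k b (?v b) *\<^sub>R frame k b)) differentiable (at a)"
    by (intro differentiable_diff differentiable_sum differentiable_scaleR v finite
        coord_differentiable[OF a v] frame_differentiable[OF a] ballI)
  then obtain D where "((\<lambda>b. ?v b - (\<Sum>k\<in>UNIV. coord k b (?v b) *\<^sub>R frame k b)) has_derivative D) (at a)"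
    by (auto simp: differentiable_def)
  then have "(sff_coef i j has_derivative D) (at a)"
    by (rule has_derivative_transform_within_open[OF _ open_domain a])
      (simp add: sff_coef_def nor_part_eq)
  then show ?thesis by (auto simp: differentiable_def)
qed

text \<open>The bilinear form with these coefficients. It agrees with the second fundamental form on
  tangent vectors and is defined for all vectors, through their tangential parts.\<close>

definition sff_form :: "real^2 \<Rightarrow> real^5 \<Rightarrow> real^5 \<Rightarrow> real^5" where
  "sff_form a x y = (\<Sum>i\<in>UNIV. \<Sum>j\<in>UNIV. (coord i a x * coord j a y) *\<^sub>R sff_coef i j a)"

lemma sff_form_linear_left: "linear (\<lambda>x. sff_form a x y)"
  by (rule linearI)
    (simp_all add: sff_form_def linear_add[OF coord_linear] linear_cmul[OF coord_linear]
      algebra_simps sum.distrib scaleR_sum_right)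

lemma sff_form_linear_right: "linear (sff_form a x)"
  by (rule linearI)
    (simp_all add: sff_form_def linear_add[OF coord_linear] linear_cmul[OF coord_linear]
      algebra_simps sum.distrib scaleR_sum_right)

lemma field_differentiable:
  assumes "a \<in> U" and "\<phi> a \<in> W" and "tangent_field_on S A F W Y"
  shows "(Y \<circ> \<phi>) differentiable (at a)"
proof -
  have "smooth_on {b \<in> U. \<phi> b \<in> W} (Y \<circ> \<phi>)"
    using assms(3) chart unfolding tangent_field_on_def by blast
  then show ?thesis by (rule smooth_on_differentiable) (use assms in simp)
qed

lemma field_domain_open: "tangent_field_on S A F W Y \<Longrightarrow> open {b \<in> U. \<phi> b \<in> W}"
  by (rule chart_preimage_open[OF chart]) (simp add: tangent_field_on_def)

text \<open>In the Leibniz rule for \<open>Y = (\<Sum>i. Y\<^sup>i \<partial>\<^sub>i)\<close> the derivatives of the components only contribute a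
  tangential term.\<close>

lemma field_derivative:
  assumes a: "a \<in> U" "\<phi> a \<in> W" and Y: "tangent_field_on S A F W Y"
  shows "frechet_derivative (Y \<circ> \<phi>) (at a) \<xi> =
    (\<Sum>i\<in>UNIV. frechet_derivative (\<lambda>b. coord i b (Y (\<phi> b))) (at a) \<xi> *\<^sub>R frame i a)
    + (\<Sum>i\<in>UNIV. coord i a (Y (\<phi> a)) *\<^sub>R frechet_derivative (frame i) (at a) \<xi>)"
proof -
  let ?c = "\<lambda>i b. coord i b (Y (\<phi> b))"
  have dY: "(\<lambda>b. Y (\<phi> b)) differentiable (at a)"
    using field_differentiable[OF a Y] by (simp add: o_def)
  have dc: "(?c i has_derivative frechet_derivative (?c i) (at a)) (at a)" for i
    using coord_differentiable[OF a(1) dY] by (simp only: frechet_derivative_works)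
  have df: "(frame i has_derivative frechet_derivative (frame i) (at a)) (at a)" for i
    using frame_differentiable[OF a(1)] by (simp only: frechet_derivative_works)
  have "((\<lambda>b. \<Sum>i\<in>UNIV. ?c i b *\<^sub>R frame i b) has_derivative
      (\<lambda>\<xi>. \<Sum>i\<in>UNIV. ?c i a *\<^sub>R frechet_derivative (frame i) (at a) \<xi> +
         frechet_derivative (?c i) (at a) \<xi> *\<^sub>R frame i a)) (at a)"
    by (intro has_derivative_sum has_derivative_scaleR dc df)
  then have "((Y \<circ> \<phi>) has_derivative
      (\<lambda>\<xi>. \<Sum>i\<in>UNIV. ?c i a *\<^sub>R frechet_derivative (frame i) (at a) \<xi> +
         frechet_derivative (?c i) (at a) \<xi> *\<^sub>R frame i a)) (at a)"
  proof (rule has_derivative_transform_within_open[OF _ field_domain_open[OF Y]])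
    show "a \<in> {b \<in> U. \<phi> b \<in> W}" using a by simp
    fix b assume b: "b \<in> {b \<in> U. \<phi> b \<in> W}"
    then have "Y (\<phi> b) \<in> tangent_space_at A F (\<phi> b)"
      using Y by (auto simp: tangent_field_on_def)
    with b show "(\<Sum>i\<in>UNIV. ?c i b *\<^sub>R frame i b) = (Y \<circ> \<phi>) b"
      using tangent_combination[of b "Y (\<phi> b)"] by simp
  qed
  from frechet_derivative_at[OF this, symmetric] show ?thesis
    by (simp add: sum.distrib)
qed

text \<open>Taking normal parts removes the derivatives of the components of \<open>Y\<close>; what remains depends on
  the value of \<open>Y\<close> at the point only.\<close>

lemma nor_dir_deriv_field:
  assumes a: "a \<in> U" "\<phi> a \<in> W" and Y: "tangent_field_on S A F W Y"
    and x: "x \<in> tangent_space_at A F (\<phi> a)"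
  shows "nor_part A F (\<phi> a) (dir_deriv A F (\<phi> a) x Y) = sff_form a x (Y (\<phi> a))"
proof -
  let ?N = "nor_part A F (\<phi> a)" and ?\<xi> = "param_vec a x"
  note lin = nor_part_linear[OF a(1)]
  have "dir_deriv A F (\<phi> a) x Y = frechet_derivative (Y \<circ> \<phi>) (at a) ?\<xi>"
    using dir_deriv_eq[OF a(1) field_differentiable[OF a Y], of ?\<xi>] D\<phi>_param_vec[OF a(1) x] by simp
  then have dir: "?N (dir_deriv A F (\<phi> a) x Y) = ?N (frechet_derivative (Y \<circ> \<phi>) (at a) ?\<xi>)"
    by simp
  have "?N (dir_deriv A F (\<phi> a) x Y) =
      (\<Sum>j\<in>UNIV. coord j a (Y (\<phi> a)) *\<^sub>R ?N (frechet_derivative (frame j) (at a) ?\<xi>))"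
    unfolding dir field_derivative[OF a Y] linear_add[OF lin] nor_part_combination[OF a(1)] add_0_left
    by (simp only: linear_sum[OF lin] linear_cmul[OF lin])
  moreover have "?N (frechet_derivative (frame j) (at a) ?\<xi>) =
      (\<Sum>i\<in>UNIV. coord i a x *\<^sub>R sff_coef i j a)" for j
  proof -
    have lf: "linear (frechet_derivative (frame j) (at a))"
      by (rule linear_frechet_derivative[OF frame_differentiable[OF a(1)]])
    have "?\<xi> = (\<Sum>i\<in>UNIV. coord i a x *\<^sub>R axis i 1)"
      using basis_expansion[of ?\<xi>] by (simp add: param_vec_def scalar_mult_eq_scaleR)
    then show ?thesis
      by (simp add: linear_sum[OF lf] linear_cmul[OF lf] linear_sum[OF lin] linear_cmul[OF lin]
          sff_coef_def)
  qed
  ultimately have "?N (dir_deriv A F (\<phi> a) x Y) =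
      (\<Sum>j\<in>UNIV. \<Sum>i\<in>UNIV. (coord i a x * coord j a (Y (\<phi> a))) *\<^sub>R sff_coef i j a)"
    by (simp add: scaleR_sum_right mult.commute)
  also have "\<dots> = sff_form a x (Y (\<phi> a))"
    unfolding sff_form_def by (rule sum.swap)
  finally show ?thesis .
qed

lemma extension_of_tangent_vector:
  assumes "a \<in> U" and "y \<in> tangent_space_at A F (\<phi> a)"
  obtains Y where "tangent_field_on S A F (\<phi> ` U) Y" and "Y (\<phi> a) = y"
  using extension_field[of "param_vec a y"] D\<phi>_param_vec[OF assms] assms(1) by metis

lemma sff_eq:
  assumes a: "a \<in> U" and x: "x \<in> tangent_space_at A F (\<phi> a)"
    and y: "y \<in> tangent_space_at A F (\<phi> a)"
  shows "sff S A F (\<phi> a) x y = sff_form a x y"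
  unfolding sff_def
proof (rule the_equality)
  obtain Y where Y: "tangent_field_on S A F (\<phi> ` U) Y" "Y (\<phi> a) = y"
    using extension_of_tangent_vector[OF a y] .
  have p: "\<phi> a \<in> \<phi> ` U" using a by simp
  show "\<exists>W Y. \<phi> a \<in> W \<and> tangent_field_on S A F W Y \<and> Y (\<phi> a) = y \<and>
      sff_form a x y = nor_part A F (\<phi> a) (dir_deriv A F (\<phi> a) x Y)"
    using p Y nor_dir_deriv_field[OF a p Y(1) x] by metis
next
  fix w
  assume "\<exists>W Y. \<phi> a \<in> W \<and> tangent_field_on S A F W Y \<and> Y (\<phi> a) = y \<and>
      w = nor_part A F (\<phi> a) (dir_deriv A F (\<phi> a) x Y)"
  then show "w = sff_form a x y" using nor_dir_deriv_field[OF a _ _ x] by metis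
qed

section \<open>The covariant derivative in a chart\<close>

lemma sff_form_tan_part_left: "a \<in> U \<Longrightarrow> sff_form a (tan_part A F (\<phi> a) v) z = sff_form a v z"
  by (simp add: sff_form_def tan_part_eq coord_combination)

lemma sff_form_tan_part_right: "a \<in> U \<Longrightarrow> sff_form a y (tan_part A F (\<phi> a) v) = sff_form a y v"
  by (simp add: sff_form_def tan_part_eq coord_combination)

lemma tan_part_in_tangent_space: "a \<in> U \<Longrightarrow> tan_part A F (\<phi> a) v \<in> tangent_space_at A F (\<phi> a)"
proof -
  assume a: "a \<in> U"
  have "tan_part A F (\<phi> a) v = D\<phi> a (param_vec a v)"
    using a by (simp add: tan_part_eq D\<phi>_frame param_vec_def)
  then show ?thesis using a by (simp add: tangent_space_eq_range)
qed

text \<open>The derivative in direction \<open>x\<close> of the field with constant components equal to those of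
  \<open>y\<close>; its tangential part is given by the Christoffel symbols.\<close>

definition connection_term :: "real^2 \<Rightarrow> real^5 \<Rightarrow> real^5 \<Rightarrow> real^5" where
  "connection_term a x y =
     (\<Sum>i\<in>UNIV. coord i a y *\<^sub>R frechet_derivative (frame i) (at a) (param_vec a x))"

text \<open>The defining expression of \<open>\<nabla>\<alpha>\<close> for the extensions with constant components.\<close>

definition cov_form :: "real^2 \<Rightarrow> real^5 \<Rightarrow> real^5 \<Rightarrow> real^5 \<Rightarrow> real^5" where
  "cov_form a x y z =
     nor_part A F (\<phi> a) (\<Sum>i\<in>UNIV. \<Sum>j\<in>UNIV. (coord i a y * coord j a z) *\<^sub>R
       frechet_derivative (sff_coef i j) (at a) (param_vec a x))
     - sff_form a (connection_term a x y) z - sff_form a y (connection_term a x z)"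

text \<open>Tensoriality of \<open>\<nabla>\<alpha>\<close>. Compared with constant components, \<open>\<nabla>\<^sup>\<bottom>(\<alpha>(Y, Z))\<close> gains the terms in
  which a component of \<open>Y\<close> or \<open>Z\<close> is differentiated, each multiplied by a coefficient of \<open>\<alpha>\<close>. The
  same terms occur in \<open>\<alpha>(\<nabla>\<^sup>\<top>Y, Z)\<close> and \<open>\<alpha>(Y, \<nabla>\<^sup>\<top>Z)\<close>, and cancel. The tangential parts there may be
  left out, since \<open>sff_form\<close> only sees tangential parts.\<close>

lemma cov_form_eq_field_expression:
  assumes a: "a \<in> U" "\<phi> a \<in> W"
    and Y: "tangent_field_on S A F W Y" and Z: "tangent_field_on S A F W Z"
    and x: "x \<in> tangent_space_at A F (\<phi> a)"
  shows "nor_part A F (\<phi> a) (dir_deriv A F (\<phi> a) x (\<lambda>q. sff S A F q (Y q) (Z q)))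
      - sff S A F (\<phi> a) (tan_part A F (\<phi> a) (dir_deriv A F (\<phi> a) x Y)) (Z (\<phi> a))
      - sff S A F (\<phi> a) (Y (\<phi> a)) (tan_part A F (\<phi> a) (dir_deriv A F (\<phi> a) x Z))
    = cov_form a x (Y (\<phi> a)) (Z (\<phi> a))"
proof -
  let ?p = "\<phi> a" and ?\<xi> = "param_vec a x"
  let ?N = "nor_part A F (\<phi> a)"
  let ?B = "\<lambda>q. sff S A F q (Y q) (Z q)"
  let ?c = "\<lambda>i b. coord i b (Y (\<phi> b))" and ?d = "\<lambda>j b. coord j b (Z (\<phi> b))"
  let ?Dc = "\<lambda>i. frechet_derivative (?c i) (at a)" and ?Dd = "\<lambda>j. frechet_derivative (?d j) (at a)"
  let ?DB = "\<lambda>i j. frechet_derivative (sff_coef i j) (at a)"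
  note lin = nor_part_linear[OF a(1)]
  have tangent: "Y (\<phi> b) \<in> tangent_space_at A F (\<phi> b)" "Z (\<phi> b) \<in> tangent_space_at A F (\<phi> b)"
    if "\<phi> b \<in> W" for b
    using Y Z that by (auto simp: tangent_field_on_def)
  have dir: "dir_deriv A F ?p x V = frechet_derivative (V \<circ> \<phi>) (at a) ?\<xi>"
    if "(V \<circ> \<phi>) differentiable (at a)" for V
    using dir_deriv_eq[OF a(1) that, of ?\<xi>] D\<phi>_param_vec[OF a(1) x] by simp
  have dc: "(?c i has_derivative ?Dc i) (at a)" for i
    using coord_differentiable[OF a(1) field_differentiable[OF a Y]]
    by (simp only: frechet_derivative_works[symmetric] o_def)
  have dd: "(?d i has_derivative ?Dd i) (at a)" for i
    using coord_differentiable[OF a(1) field_differentiable[OF a Z]]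
    by (simp only: frechet_derivative_works[symmetric] o_def)
  have dB: "(sff_coef i j has_derivative ?DB i j) (at a)" for i j
    using sff_coef_differentiable[OF a(1)] by (simp only: frechet_derivative_works)
  have "((\<lambda>b. \<Sum>i\<in>UNIV. \<Sum>j\<in>UNIV. (?c i b * ?d j b) *\<^sub>R sff_coef i j b) has_derivative
      (\<lambda>\<xi>. \<Sum>i\<in>UNIV. \<Sum>j\<in>UNIV. (?c i a * ?d j a) *\<^sub>R ?DB i j \<xi>
         + (?c i a * ?Dd j \<xi> + ?Dc i \<xi> * ?d j a) *\<^sub>R sff_coef i j a)) (at a)"
    by (intro has_derivative_sum has_derivative_scaleR has_derivative_mult dc dd dB)
  then have DB: "((?B \<circ> \<phi>) has_derivative
      (\<lambda>\<xi>. \<Sum>i\<in>UNIV. \<Sum>j\<in>UNIV. (?c i a * ?d j a) *\<^sub>R ?DB i j \<xi>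
         + (?c i a * ?Dd j \<xi> + ?Dc i \<xi> * ?d j a) *\<^sub>R sff_coef i j a)) (at a)"
  proof (rule has_derivative_transform_within_open[OF _ field_domain_open[OF Y]])
    show "a \<in> {b \<in> U. \<phi> b \<in> W}" using a by simp
    show "(\<Sum>i\<in>UNIV. \<Sum>j\<in>UNIV. (?c i b * ?d j b) *\<^sub>R sff_coef i j b) = (?B \<circ> \<phi>) b"
      if "b \<in> {b \<in> U. \<phi> b \<in> W}" for b
      using that sff_eq[of b "Y (\<phi> b)" "Z (\<phi> b)"] tangent[of b] by (simp add: sff_form_def)
  qed
  then have "(?B \<circ> \<phi>) differentiable (at a)" by (auto simp: differentiable_def)
  from dir[OF this] have "dir_deriv A F ?p x ?B =
      (\<Sum>i\<in>UNIV. \<Sum>j\<in>UNIV. (?c i a * ?d j a) *\<^sub>R ?DB i j ?\<xi>)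
      + (\<Sum>i\<in>UNIV. \<Sum>j\<in>UNIV. (?c i a * ?Dd j ?\<xi>) *\<^sub>R sff_coef i j a)
      + (\<Sum>i\<in>UNIV. \<Sum>j\<in>UNIV. (?Dc i ?\<xi> * ?d j a) *\<^sub>R sff_coef i j a)"
    unfolding frechet_derivative_at[OF DB, symmetric]
    by (simp add: sum.distrib scaleR_add_left)
  \<comment> \<open>The coefficients of \<open>\<alpha>\<close> are normal, so the undifferentiated ones pass unchanged
    through the normal part and can cancel below.\<close>
  moreover have "?N (sff_coef i j a) = sff_coef i j a" for i j
    using nor_part_idem[OF a(1)] by (simp add: sff_coef_def)
  ultimately have 1: "?N (dir_deriv A F ?p x ?B) =
      ?N (\<Sum>i\<in>UNIV. \<Sum>j\<in>UNIV. (?c i a * ?d j a) *\<^sub>R ?DB i j ?\<xi>)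
      + (\<Sum>i\<in>UNIV. \<Sum>j\<in>UNIV. (?c i a * ?Dd j ?\<xi>) *\<^sub>R sff_coef i j a)
      + (\<Sum>i\<in>UNIV. \<Sum>j\<in>UNIV. (?Dc i ?\<xi> * ?d j a) *\<^sub>R sff_coef i j a)"
    by (simp only: linear_add[OF lin] linear_sum[OF lin] linear_cmul[OF lin])
  have 2: "sff S A F ?p (tan_part A F ?p (dir_deriv A F ?p x Y)) (Z ?p) =
      (\<Sum>i\<in>UNIV. \<Sum>j\<in>UNIV. (?Dc i ?\<xi> * ?d j a) *\<^sub>R sff_coef i j a)
      + sff_form a (connection_term a x (Y ?p)) (Z ?p)"
    unfolding sff_eq[OF a(1) tan_part_in_tangent_space[OF a(1)] tangent(2)[OF a(2)]]
      sff_form_tan_part_left[OF a(1)] dir[OF field_differentiable[OF a Y]] field_derivative[OF a Y]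
      linear_add[OF sff_form_linear_left] connection_term_def
    by (simp add: sff_form_def coord_combination[OF a(1)])
  have 3: "sff S A F ?p (Y ?p) (tan_part A F ?p (dir_deriv A F ?p x Z)) =
      (\<Sum>i\<in>UNIV. \<Sum>j\<in>UNIV. (?c i a * ?Dd j ?\<xi>) *\<^sub>R sff_coef i j a)
      + sff_form a (Y ?p) (connection_term a x (Z ?p))"
    unfolding sff_eq[OF a(1) tangent(1)[OF a(2)] tan_part_in_tangent_space[OF a(1)]]
      sff_form_tan_part_right[OF a(1)] dir[OF field_differentiable[OF a Z]] field_derivative[OF a Z]
      linear_add[OF sff_form_linear_right] connection_term_def
    by (simp add: sff_form_def coord_combination[OF a(1)])
  show ?thesis unfolding 1 2 3 cov_form_def by (simp add: algebra_simps)
qed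

lemma cov_sff_eq:
  assumes a: "a \<in> U" and x: "x \<in> tangent_space_at A F (\<phi> a)"
    and y: "y \<in> tangent_space_at A F (\<phi> a)" and z: "z \<in> tangent_space_at A F (\<phi> a)"
  shows "cov_sff S A F (\<phi> a) x y z = cov_form a x y z"
  unfolding cov_sff_def
proof (rule the_equality)
  obtain Y where Y: "tangent_field_on S A F (\<phi> ` U) Y" "Y (\<phi> a) = y"
    using extension_of_tangent_vector[OF a y] .
  obtain Z where Z: "tangent_field_on S A F (\<phi> ` U) Z" "Z (\<phi> a) = z"
    using extension_of_tangent_vector[OF a z] .
  have p: "\<phi> a \<in> \<phi> ` U" using a by simp
  show "\<exists>W Y Z. \<phi> a \<in> W \<and> tangent_field_on S A F W Y \<and> tangent_field_on S A F W Z \<and>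
      Y (\<phi> a) = y \<and> Z (\<phi> a) = z \<and>
      cov_form a x y z = nor_part A F (\<phi> a) (dir_deriv A F (\<phi> a) x (\<lambda>q. sff S A F q (Y q) (Z q)))
        - sff S A F (\<phi> a) (tan_part A F (\<phi> a) (dir_deriv A F (\<phi> a) x Y)) z
        - sff S A F (\<phi> a) y (tan_part A F (\<phi> a) (dir_deriv A F (\<phi> a) x Z))"
    using cov_form_eq_field_expression[OF a p Y(1) Z(1) x] Y Z p
    by (intro exI[of _ "\<phi> ` U"] exI[of _ Y] exI[of _ Z]) simp
next
  fix w
  assume "\<exists>W Y Z. \<phi> a \<in> W \<and> tangent_field_on S A F W Y \<and> tangent_field_on S A F W Z \<and>
      Y (\<phi> a) = y \<and> Z (\<phi> a) = z \<and>
      w = nor_part A F (\<phi> a) (dir_deriv A F (\<phi> a) x (\<lambda>q. sff S A F q (Y q) (Z q)))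
        - sff S A F (\<phi> a) (tan_part A F (\<phi> a) (dir_deriv A F (\<phi> a) x Y)) z
        - sff S A F (\<phi> a) y (tan_part A F (\<phi> a) (dir_deriv A F (\<phi> a) x Z))"
  then obtain W Y Z where "\<phi> a \<in> W" "tangent_field_on S A F W Y" "tangent_field_on S A F W Z"
    "Y (\<phi> a) = y" "Z (\<phi> a) = z"
    and "w = nor_part A F (\<phi> a) (dir_deriv A F (\<phi> a) x (\<lambda>q. sff S A F q (Y q) (Z q)))
        - sff S A F (\<phi> a) (tan_part A F (\<phi> a) (dir_deriv A F (\<phi> a) x Y)) z
        - sff S A F (\<phi> a) y (tan_part A F (\<phi> a) (dir_deriv A F (\<phi> a) x Z))"
    by (elim exE conjE)
  with cov_form_eq_field_expression[OF a _ _ _ x, of W Y Z] show "w = cov_form a x y z"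
    by simp
qed

end

section \<open>Critical points of the Taylor polynomial\<close>

text \<open>All terms of the Taylor polynomial above the linear one are such products, with both factors
  zero at the origin.\<close>

lemma has_derivative_bilinear_zero:
  assumes "bounded_bilinear b"
    and "(f has_derivative f') (at c)" "f c = 0" and "(g has_derivative g') (at c)" "g c = 0"
  shows "((\<lambda>x. b (f x) (g x)) has_derivative (\<lambda>_. 0)) (at c)"
  using bounded_bilinear.FDERIV[OF assms(1,2,4)] assms(3,5)
  by (simp add: bounded_bilinear.zero_left[OF assms(1)] bounded_bilinear.zero_right[OF assms(1)])

context surface_chart
begin

lemma sff_form_bounded_bilinear: "bounded_bilinear (sff_form a)"
  unfolding bilinear_conv_bounded_bilinear[symmetric] bilinear_def
  using sff_form_linear_left sff_form_linear_right by blast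

lemma sff_form_zero: "sff_form a 0 y = 0" "sff_form a x 0 = 0"
  by (simp_all add: bounded_bilinear.zero_left[OF sff_form_bounded_bilinear]
      bounded_bilinear.zero_right[OF sff_form_bounded_bilinear])

text \<open>Every term is at least quadratic in \<open>x\<close>: it is obtained by bilinear operations from linear
  functions of \<open>x\<close>.\<close>

lemma has_derivative_cov_form_diagonal:
  assumes a: "a \<in> U"
  shows "((\<lambda>x. cov_form a x x x) has_derivative (\<lambda>_. 0)) (at 0)"
proof -
  have id: "((\<lambda>x::real^5. x) has_derivative (\<lambda>x. x)) (at 0)" by simp
  have lin_param: "linear (\<lambda>x. frechet_derivative f (at a) (param_vec a x))"
    if "f differentiable (at a)" for f :: "real^2 \<Rightarrow> real^5"
    using linear_compose[OF param_vec_linear linear_frechet_derivative[OF that]] by (simp add: o_def)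
  note coord_deriv = linear_imp_has_derivative[OF coord_linear]
  have conn: "((\<lambda>x. connection_term a x x) has_derivative (\<lambda>_. 0)) (at 0)"
  proof -
    have "((\<lambda>x. connection_term a x x) has_derivative (\<lambda>_. \<Sum>i\<in>(UNIV::2 set). 0)) (at 0)"
      unfolding connection_term_def
      by (intro has_derivative_sum has_derivative_bilinear_zero[OF bounded_bilinear_scaleR coord_deriv
            _ linear_imp_has_derivative[OF lin_param[OF frame_differentiable[OF a]]]]
          linear_0[OF coord_linear] linear_0[OF lin_param[OF frame_differentiable[OF a]]])
    then show ?thesis by simp
  qed
  have conn0: "connection_term a 0 0 = 0"
    by (simp add: connection_term_def linear_0[OF coord_linear])
  have "((\<lambda>x. \<Sum>i\<in>UNIV. \<Sum>j\<in>UNIV. (coord i a x * coord j a x) *\<^sub>R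
      frechet_derivative (sff_coef i j) (at a) (param_vec a x)) has_derivative
      (\<lambda>_. \<Sum>i\<in>(UNIV::2 set). \<Sum>j\<in>(UNIV::2 set). 0)) (at 0)"
  proof (intro has_derivative_sum)
    fix i j :: 2
    note l = lin_param[OF sff_coef_differentiable[OF a]]
    have "((\<lambda>x. coord i a x * coord j a x) has_derivative (\<lambda>_. 0)) (at 0)"
      by (rule has_derivative_bilinear_zero[OF bounded_bilinear_mult coord_deriv _ coord_deriv])
        (simp_all add: linear_0[OF coord_linear])
    then show "((\<lambda>x. (coord i a x * coord j a x) *\<^sub>R
        frechet_derivative (sff_coef i j) (at a) (param_vec a x)) has_derivative (\<lambda>_. 0)) (at 0)"
      by (rule has_derivative_bilinear_zero[OF bounded_bilinear_scaleR _ _ linear_imp_has_derivative[OF l]])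
        (simp_all add: linear_0[OF coord_linear] linear_0[OF l])
  qed
  then have "((\<lambda>x. nor_part A F (\<phi> a) (\<Sum>i\<in>UNIV. \<Sum>j\<in>UNIV. (coord i a x * coord j a x) *\<^sub>R
      frechet_derivative (sff_coef i j) (at a) (param_vec a x))) has_derivative
      (\<lambda>_. nor_part A F (\<phi> a) 0)) (at 0)"
    using has_derivative_compose[OF _ linear_imp_has_derivative[OF nor_part_linear[OF a]]] by simp
  moreover have "((\<lambda>x. sff_form a (connection_term a x x) x) has_derivative (\<lambda>_. 0)) (at 0)"
    by (rule has_derivative_bilinear_zero[OF sff_form_bounded_bilinear conn conn0 id refl])
  moreover have "((\<lambda>x. sff_form a x (connection_term a x x)) has_derivative (\<lambda>_. 0)) (at 0)"
    by (rule has_derivative_bilinear_zero[OF sff_form_bounded_bilinear id refl conn conn0])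
  ultimately have "((\<lambda>x. cov_form a x x x) has_derivative (\<lambda>_. nor_part A F (\<phi> a) 0 - 0 - 0)) (at 0)"
    unfolding cov_form_def by (intro has_derivative_diff)
  then show ?thesis by (simp add: linear_0[OF nor_part_linear[OF a]])
qed

lemma taylor3_eq:
  assumes "a \<in> U" and "x \<in> tangent_space_at A F (\<phi> a)"
  shows "taylor3 S A F (\<phi> a) u x = u \<bullet> x + 1/2 * (u \<bullet> sff_form a x x)
     - 1/6 * (sff_form a (tan_part A F (\<phi> a) u) x \<bullet> sff_form a x x)
     + 1/6 * (nor_part A F (\<phi> a) u \<bullet> cov_form a x x x)"
  using assms by (simp add: taylor3_def sff_eq cov_sff_eq tan_part_in_tangent_space)

lemma taylor3_nonlinear_part_derivative:
  assumes a: "a \<in> U"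
  shows "((\<lambda>x. taylor3 S A F (\<phi> a) u x - u \<bullet> x) has_derivative (\<lambda>_. 0))
    (at 0 within tangent_space_at A F (\<phi> a))"
proof -
  let ?t = "tan_part A F (\<phi> a) u" and ?n = "nor_part A F (\<phi> a) u"
  have id: "((\<lambda>x::real^5. x) has_derivative (\<lambda>x. x)) (at 0)" by simp
  have q: "((\<lambda>x. sff_form a x x) has_derivative (\<lambda>_. 0)) (at 0)"
    by (rule has_derivative_bilinear_zero[OF sff_form_bounded_bilinear id refl id refl])
  have c: "((\<lambda>x. sff_form a ?t x \<bullet> sff_form a x x) has_derivative (\<lambda>_. 0)) (at 0)"
    by (rule has_derivative_bilinear_zero[OF bounded_bilinear_inner
          linear_imp_has_derivative[OF sff_form_linear_right] _ q]) (simp_all add: sff_form_zero)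
  have "((\<lambda>x. 1/2 * (u \<bullet> sff_form a x x) - 1/6 * (sff_form a ?t x \<bullet> sff_form a x x)
      + 1/6 * (?n \<bullet> cov_form a x x x)) has_derivative
      (\<lambda>_. 1/2 * (u \<bullet> 0) - 1/6 * 0 + 1/6 * (?n \<bullet> 0))) (at 0)"
    by (intro has_derivative_add has_derivative_diff has_derivative_mult_right
        has_derivative_inner_right q c has_derivative_cov_form_diagonal[OF a])
  then have "((\<lambda>x. 1/2 * (u \<bullet> sff_form a x x) - 1/6 * (sff_form a ?t x \<bullet> sff_form a x x)
      + 1/6 * (?n \<bullet> cov_form a x x x)) has_derivative (\<lambda>_. 0))
      (at 0 within tangent_space_at A F (\<phi> a))"
    by (simp add: has_derivative_at_withinI)
  moreover have "0 \<in> tangent_space_at A F (\<phi> a)"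
    by (rule subspace_0[OF tangent_subspace[OF a]])
  ultimately show ?thesis
    by (rule has_derivative_transform[rotated 2]) (simp add: taylor3_eq[OF a])
qed

text \<open>Derivatives within the tangent space are only determined along it, so \<open>u \<bullet> x\<close> has derivative
  \<open>0\<close> there exactly when \<open>u\<close> is orthogonal to it; lines through \<open>0\<close> detect this.\<close>

lemma taylor3_critical_iff_normal:
  assumes a: "a \<in> U"
  shows "taylor3_critical S A F (\<phi> a) u \<longleftrightarrow> u \<in> normal_space_at A F (\<phi> a)"
proof
  let ?T = "tangent_space_at A F (\<phi> a)"
  assume "taylor3_critical S A F (\<phi> a) u"
  then have "(taylor3 S A F (\<phi> a) u has_derivative (\<lambda>_. 0)) (at 0 within ?T)"
    by (simp add: taylor3_critical_def)
  from has_derivative_diff[OF this taylor3_nonlinear_part_derivative[OF a, of u]]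
  have d: "((\<lambda>x. u \<bullet> x) has_derivative (\<lambda>_. 0)) (at 0 within ?T)" by simp
  have "u \<bullet> y = 0" if y: "y \<in> ?T" for y
  proof -
    have line: "((\<lambda>t::real. t *\<^sub>R y) has_derivative (\<lambda>t. t *\<^sub>R y)) (at 0)"
      by (intro has_derivative_scaleR_left has_derivative_ident)
    have "range (\<lambda>t. t *\<^sub>R y) \<subseteq> ?T"
      using subspace_scale[OF tangent_subspace[OF a] y] by auto
    then have "((\<lambda>x. u \<bullet> x) has_derivative (\<lambda>_. 0)) (at (0 *\<^sub>R y) within range (\<lambda>t. t *\<^sub>R y))"
      using has_derivative_subset[OF d] by simp
    from has_derivative_in_compose[OF line this]
    have "((\<lambda>t::real. u \<bullet> (t *\<^sub>R y)) has_derivative (\<lambda>_. 0)) (at 0)" .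
    moreover have "((\<lambda>t::real. u \<bullet> (t *\<^sub>R y)) has_derivative (\<lambda>t. u \<bullet> (t *\<^sub>R y))) (at 0)"
      by (rule has_derivative_inner_right[OF line])
    ultimately have "(\<lambda>t::real. u \<bullet> (t *\<^sub>R y)) = (\<lambda>_. 0)"
      by (metis has_derivative_unique)
    from fun_cong[OF this, of 1] show ?thesis by simp
  qed
  then show "u \<in> normal_space_at A F (\<phi> a)"
    by (simp add: normal_space_at_def orthogonal_comp_def orthogonal_def inner_commute)
next
  let ?T = "tangent_space_at A F (\<phi> a)"
  assume "u \<in> normal_space_at A F (\<phi> a)"
  then have "u \<bullet> y = 0" if "y \<in> ?T" for y
    using that by (auto simp: normal_space_at_def orthogonal_comp_def orthogonal_def inner_commute)
  moreover have "0 \<in> ?T" by (rule subspace_0[OF tangent_subspace[OF a]])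
  ultimately have "(taylor3 S A F (\<phi> a) u has_derivative (\<lambda>_. 0)) (at 0 within ?T)"
    by (intro has_derivative_transform[OF _ _ taylor3_nonlinear_part_derivative[OF a, of u]]) simp_all
  then show "taylor3_critical S A F (\<phi> a) u" by (simp add: taylor3_critical_def)
qed

lemma normal_imp_tan_part_zero:
  assumes a: "a \<in> U" and u: "u \<in> normal_space_at A F (\<phi> a)"
  shows "tan_part A F (\<phi> a) u = 0"
  unfolding tan_part_def
proof (rule the_equality)
  show *: "0 \<in> tangent_space_at A F (\<phi> a) \<and> u - 0 \<in> normal_space_at A F (\<phi> a)"
    using u subspace_0[OF tangent_subspace[OF a]] by simp
  show "w = 0" if "w \<in> tangent_space_at A F (\<phi> a) \<and> u - w \<in> normal_space_at A F (\<phi> a)" for w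
    using that * orthogonal_decomposition_unique[OF tangent_subspace[OF a], of w u 0]
    by (simp add: normal_space_at_def)
qed

text \<open>For normal \<open>u\<close> with \<open>u \<bullet> \<alpha>(x, y) = 0\<close> for all \<open>y\<close>, only the cubic term of the Taylor
  polynomial survives at \<open>x\<close>.\<close>

lemma asymptotic_direction_iff_normal_vector:
  assumes a: "a \<in> U" and T: "span {t1, t2} = tangent_space_at A F (\<phi> a)"
    and x: "x \<in> tangent_space_at A F (\<phi> a)" "x \<noteq> 0"
  shows "asymptotic_direction S A F (\<phi> a) x \<longleftrightarrow>
    (\<exists>u\<in>normal_space_at A F (\<phi> a). u \<noteq> 0 \<and> u \<bullet> sff S A F (\<phi> a) x t1 = 0 \<and>
       u \<bullet> sff S A F (\<phi> a) x t2 = 0 \<and> u \<bullet> cov_sff S A F (\<phi> a) x x x = 0)"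
proof -
  let ?T = "tangent_space_at A F (\<phi> a)" and ?N = "normal_space_at A F (\<phi> a)"
  let ?\<alpha> = "sff S A F (\<phi> a)" and ?C = "cov_sff S A F (\<phi> a) x x x"
  have t: "t1 \<in> ?T" "t2 \<in> ?T" using span_base[of _ "{t1, t2}"] unfolding T by auto
  have "binormal_witness S A F (\<phi> a) u x \<longleftrightarrow> u \<bullet> ?\<alpha> x t1 = 0 \<and> u \<bullet> ?\<alpha> x t2 = 0 \<and> u \<bullet> ?C = 0"
    if u: "u \<in> ?N" for u
  proof -
    have "(\<forall>y\<in>?T. u \<bullet> ?\<alpha> x y = 0) \<longleftrightarrow> u \<bullet> ?\<alpha> x t1 = 0 \<and> u \<bullet> ?\<alpha> x t2 = 0"
    proof
      assume *: "u \<bullet> ?\<alpha> x t1 = 0 \<and> u \<bullet> ?\<alpha> x t2 = 0"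
      have "subspace {y. u \<bullet> sff_form a x y = 0}"
        by (simp add: subspace_def sff_form_zero linear_add[OF sff_form_linear_right]
            linear_cmul[OF sff_form_linear_right] inner_add_right)
      then have "?T \<subseteq> {y. u \<bullet> sff_form a x y = 0}"
        unfolding T[symmetric] using * t x by (intro span_minimal) (simp_all add: sff_eq[OF a])
      then show "\<forall>y\<in>?T. u \<bullet> ?\<alpha> x y = 0" using x by (auto simp: sff_eq[OF a])
    qed (use t in blast)
    moreover have "taylor3 S A F (\<phi> a) u x = 1/6 * (u \<bullet> ?C)" if "\<forall>y\<in>?T. u \<bullet> ?\<alpha> x y = 0"
    proof -
      have "u \<bullet> x = 0"
        using u x by (auto simp: normal_space_at_def orthogonal_comp_def orthogonal_def inner_commute)
      moreover have "?\<alpha> 0 x = 0"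
        using sff_eq[OF a _ x(1)] subspace_0[OF tangent_subspace[OF a]] by (simp add: sff_form_zero)
      ultimately show ?thesis
        using that x by (simp add: taylor3_def nor_part_def normal_imp_tan_part_zero[OF a u])
    qed
    ultimately show ?thesis using x unfolding binormal_witness_def by auto
  qed
  then show ?thesis
    unfolding asymptotic_direction_def taylor3_critical_iff_normal[OF a] by blast
qed

end

section \<open>Determinants and orthogonal vectors\<close>

lemma orthonormal_basis_expansion:
  assumes "orthonormal_basis N e" and "u \<in> N"
  shows "u = (\<Sum>j\<in>UNIV. (u \<bullet> e j) *\<^sub>R e j)"
proof -
  have "linear (\<lambda>u. \<Sum>j\<in>UNIV. (u \<bullet> e j) *\<^sub>R e j)"
    by (rule linearI) (simp_all add: inner_add_left scaleR_add_left sum.distrib scaleR_sum_right)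
  moreover have "e i = (\<Sum>j\<in>UNIV. (e i \<bullet> e j) *\<^sub>R e j)" for i
  proof -
    have "(\<Sum>j\<in>UNIV. (e i \<bullet> e j) *\<^sub>R e j) = (\<Sum>j\<in>UNIV. if i = j then e j else 0)"
      using assms(1) by (intro sum.cong) (simp_all add: orthonormal_basis_def)
    then show ?thesis by simp
  qed
  moreover have "u \<in> span (range e)" using assms by (simp add: orthonormal_basis_def)
  ultimately show ?thesis
    using linear_eq_on_span[of "\<lambda>u. u" "\<lambda>u. \<Sum>j\<in>UNIV. (u \<bullet> e j) *\<^sub>R e j" "range e" u]
    by (auto simp: linear_ident)
qed

text \<open>With \<open>u = (\<Sum>j. c\<^sub>j e\<^sub>j)\<close>, the numbers \<open>u \<bullet> v\<^sub>i\<close> are the entries of \<open>M c\<close>, where \<open>M\<close> is the matrix of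
  the determinant. So a nonzero \<open>u\<close> orthogonal to all \<open>v\<^sub>i\<close> is a nonzero element of the kernel.\<close>

lemma det_wrt_eq_0_iff:
  assumes e: "orthonormal_basis N e"
  shows "det_wrt e v1 v2 v3 = 0 \<longleftrightarrow>
    (\<exists>u\<in>N. u \<noteq> 0 \<and> u \<bullet> v1 = 0 \<and> u \<bullet> v2 = 0 \<and> u \<bullet> v3 = 0)"
proof -
  define M :: "real^3^3" where "M = vector [\<chi> j. v1 \<bullet> e j, \<chi> j. v2 \<bullet> e j, \<chi> j. v3 \<bullet> e j]"
  have ee: "e i \<bullet> e j = (if i = j then 1 else 0)" for i j
    using e by (simp add: orthonormal_basis_def)
  define u where "u c = (\<Sum>j\<in>UNIV. (c $ j) *\<^sub>R e j)" for c :: "real^3"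
  have M: "M *v c = 0 \<longleftrightarrow> u c \<bullet> v1 = 0 \<and> u c \<bullet> v2 = 0 \<and> u c \<bullet> v3 = 0" for c
    by (simp add: M_def u_def vec_eq_iff forall_3 matrix_vector_mult_def
        inner_sum_left inner_commute[of "e _"] mult.commute)
  have coord: "u c \<bullet> e j = c $ j" for c j
    by (simp add: u_def inner_sum_left ee if_distrib cong: if_cong)
  have N: "u c \<in> N" for c
    using e unfolding orthonormal_basis_def u_def
    by (metis (no_types, lifting) rangeI span_base span_scale span_sum)
  have onto: "\<exists>c. w = u c" if "w \<in> N" for w
    using orthonormal_basis_expansion[OF e that]
    by (intro exI[of _ "\<chi> j. w \<bullet> e j"]) (simp add: u_def)
  have nz: "u c = 0 \<longleftrightarrow> c = 0" for c
  proof
    assume "u c = 0"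
    then have "c $ j = 0" for j using coord[of c j] by simp
    then show "c = 0" by (simp add: vec_eq_iff)
  qed (simp add: u_def)
  have "det_wrt e v1 v2 v3 = 0 \<longleftrightarrow> (\<exists>c. c \<noteq> 0 \<and> M *v c = 0)"
    unfolding det_wrt_def M_def[symmetric] using invertible_det_nz[of M]
    by (auto simp: invertible_left_inverse matrix_left_invertible_ker)
  also have "\<dots> \<longleftrightarrow> (\<exists>w\<in>N. w \<noteq> 0 \<and> w \<bullet> v1 = 0 \<and> w \<bullet> v2 = 0 \<and> w \<bullet> v3 = 0)"
  proof
    assume "\<exists>c. c \<noteq> 0 \<and> M *v c = 0"
    then obtain c where "c \<noteq> 0" "M *v c = 0" by blast
    then show "\<exists>w\<in>N. w \<noteq> 0 \<and> w \<bullet> v1 = 0 \<and> w \<bullet> v2 = 0 \<and> w \<bullet> v3 = 0"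
      using M[of c] nz[of c] by (intro bexI[of _ "u c"] N) simp
  next
    assume "\<exists>w\<in>N. w \<noteq> 0 \<and> w \<bullet> v1 = 0 \<and> w \<bullet> v2 = 0 \<and> w \<bullet> v3 = 0"
    then obtain w where w: "w \<in> N" "w \<noteq> 0" "w \<bullet> v1 = 0" "w \<bullet> v2 = 0" "w \<bullet> v3 = 0" by blast
    obtain c where "w = u c" using onto[OF w(1)] by blast
    with w show "\<exists>c. c \<noteq> 0 \<and> M *v c = 0"
      using M[of c] nz[of c] by (intro exI[of _ c]) simp
  qed
  finally show ?thesis .
qed

theorem theorem5p5:
  fixes S :: "'p topology" and A :: "'p chart set" and F :: "'p \<Rightarrow> real^5"
    and m :: 'p and t1 t2 x :: "real^5" and e :: "3 \<Rightarrow> real^5"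
  assumes "smooth_surface S A" and "immersion A F" and "m \<in> topspace S"
    and "t1 \<noteq> t2" and "independent {t1, t2}" and "span {t1, t2} = tangent_space_at A F m"
    and "orthonormal_basis (normal_space_at A F m) e"
    and "x \<in> tangent_space_at A F m" and "x \<noteq> 0"
  shows "asymptotic_direction S A F m x \<longleftrightarrow>
    det_wrt e (sff S A F m x t1) (sff S A F m x t2) (cov_sff S A F m x x x) = 0"
proof -
  interpret immersed_surface S A F by unfold_locales (fact assms)+
  obtain U \<phi> a where c: "(U, \<phi>) \<in> A" "a \<in> U" "\<phi> a = m" using chart_at[OF assms(3)] .
  interpret surface_chart S A F U \<phi> by unfold_locales (fact c)
  show ?thesis
    using asymptotic_direction_iff_normal_vector[OF c(2), of t1 t2 x] assms(6-9)
    unfolding det_wrt_eq_0_iff[OF assms(7)] c(3) by blast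
qed

end
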